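(* Let $A=\begin{bmatrix}A_1\\ A_2\end{bmatrix}\in\mathbb{R}^{m\times n}$ with $m\ge n$, $A_1\in\mathbb{R}^{p\times n}$, $A_2\in\mathbb{R}^{q\times n}$, $p+q=m$, let $b\in\mathbb{R}^m$, let $J=\begin{bmatrix}I_p&0\\ 0&-I_q\end{bmatrix}$, and assume that $A^TJA$ is symmetric positive definite. For the indefinite least squares problem $\min_{x\in\mathbb{R}^n}(b-Ax)^TJ(b-Ax)$, the splitting (SP) method $$x_{k+1}=(A_1^TA_1)^{-1}A_2^TA_2\,x_k+(A_1^TA_1)^{-1}A^TJb,\qquad k=0,1,2,\ldots,$$ converges for any initial vector $x_0$.
   Context: $I_t$ denotes the $t\times t$ identity matrix. The normal equation of the indefinite least squares problem is $A^TJAx=A^TJb$, where $A^TJA=A_1^TA_1-A_2^TA_2$; the SP method comes from rewriting it as $A_1^TA_1x=A_2^TA_2x+A^TJb$. Since $A^TJA$ is symmetric positive definite, so is $A_1^TA_1$, and the iteration is well defined. *)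

theory Defs
  imports Complex_Main "Jordan_Normal_Form.Matrix" "Jordan_Normal_Form.Gauss_Jordan_Elimination"
begin

definition sym_pos_def :: "nat \<Rightarrow> real mat \<Rightarrow> bool" where
  "sym_pos_def n M \<longleftrightarrow>
     M \<in> carrier_mat n n \<and> transpose_mat M = M \<and>
     (\<forall>v \<in> carrier_vec n. v \<noteq> 0\<^sub>v n \<longrightarrow> v \<bullet> (M *\<^sub>v v) > 0)"

text \<open>
  Convergence in the Euclidean norm. Vectors carry their dimension as data and are not an instance
  of a topological type class, so the library's limit operator cannot be applied to them directly.
\<close>

definition vec_tendsto :: "(nat \<Rightarrow> real vec) \<Rightarrow> real vec \<Rightarrow> bool" where
  "vec_tendsto x l \<longleftrightarrow>
     (\<forall>k. x k \<in> carrier_vec (dim_vec l)) \<and>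
     (\<lambda>k. sqrt ((x k - l) \<bullet> (x k - l))) \<longlonglongrightarrow> 0"

definition signature_mat :: "nat \<Rightarrow> nat \<Rightarrow> real mat" where
  "signature_mat p q = four_block_mat (1\<^sub>m p) (0\<^sub>m p q) (0\<^sub>m q p) (- 1\<^sub>m q)"

definition ils_solution :: "nat \<Rightarrow> real mat \<Rightarrow> real mat \<Rightarrow> real vec \<Rightarrow> real vec \<Rightarrow> bool" where
  "ils_solution n A J b x \<longleftrightarrow>
     is_arg_min (\<lambda>y. (b - A *\<^sub>v y) \<bullet> (J *\<^sub>v (b - A *\<^sub>v y))) (\<lambda>y. y \<in> carrier_vec n) x"

text \<open>
  The library function \<^const>\<open>mat_inverse\<close> is option-valued; \<open>the\<close> yields an unspecified matrix
  if the argument is singular.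
\<close>

abbreviation inv_mat :: "real mat \<Rightarrow> real mat" where
  "inv_mat M \<equiv> the (mat_inverse M)"

end

theory Submission
  imports Defs "Jordan_Normal_Form.Determinant"
begin

text \<open>
  Write \<open>M = A\<^sup>T J A\<close>, so that \<open>v \<bullet> M w = A\<^sub>1 v \<bullet> A\<^sub>1 w - A\<^sub>2 v \<bullet> A\<^sub>2 w\<close>. Positive definiteness makes
  \<open>M\<close> invertible, and also \<open>A\<^sub>1\<^sup>T A\<^sub>1\<close> because \<open>v \<bullet> A\<^sub>1\<^sup>T A\<^sub>1 v \<ge> v \<bullet> M v\<close>. The solution \<open>l\<close> of \<open>M l = A\<^sup>T J b\<close> minimises the quadratic
  objective because its Hessian is \<open>2 M\<close>.

  Convergence is shown by an energy argument instead of the usual bound on the spectral radius of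
  \<open>(A\<^sub>1\<^sup>T A\<^sub>1)\<^sup>-\<^sup>1 A\<^sub>2\<^sup>T A\<^sub>2\<close>. The error \<open>e\<^sub>k = x\<^sub>k - l\<close> satisfies \<open>A\<^sub>1\<^sup>T A\<^sub>1 e\<^sub>k\<^sub>+\<^sub>1 = A\<^sub>2\<^sup>T A\<^sub>2 e\<^sub>k\<close>. Pairing
  this with \<open>e\<^sub>k\<^sub>+\<^sub>1\<close> and using \<open>2 u \<bullet> w \<le> u \<bullet> u + w \<bullet> w\<close> shows that the energy
  \<open>A\<^sub>1 e\<^sub>k \<bullet> A\<^sub>1 e\<^sub>k\<close> drops in each step by at least \<open>e\<^sub>k \<bullet> M e\<^sub>k \<ge> 0\<close>
  (lemma \<open>splitting_step_energy_drop\<close>). A nonnegative decreasing sequence converges, so the drops,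
  and with them \<open>e\<^sub>k \<bullet> M e\<^sub>k\<close>, tend to zero. Finally a vanishing \<open>M\<close>-energy forces \<open>e\<^sub>k\<close> itself to
  vanish (lemma \<open>vec_tendsto_if_energy_tendsto_0\<close>): by Cauchy--Schwarz for the inner product given
  by \<open>M\<close>, \<open>v \<bullet> M e\<^sub>k\<close> tends to zero for every \<open>v\<close>, and \<open>v = M\<^sup>-\<^sup>1 u\<^sub>i\<close>, with \<open>u\<^sub>i\<close> the \<open>i\<close>-th unit
  vector, picks out the \<open>i\<close>-th coordinate. No eigenvalues and no compactness are involved.
\<close>

section \<open>Positive definite matrices\<close>

lemma inv_mat_of_injective:
  assumes N: "N \<in> carrier_mat n n"
    and inj: "\<And>v. v \<in> carrier_vec n \<Longrightarrow> N *\<^sub>v v = 0\<^sub>v n \<Longrightarrow> v = 0\<^sub>v n"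
  shows "inv_mat N \<in> carrier_mat n n" and "N * inv_mat N = 1\<^sub>m n"
proof -
  have "det N \<noteq> 0" using det_0_iff_vec_prod_zero[OF N] inj by blast
  then have "N \<in> Units (ring_mat TYPE(real) n ())" by (rule det_non_zero_imp_unit[OF N])
  then obtain B where B: "mat_inverse N = Some B"
    using mat_inverse(1)[OF N, where b = "()"] by (cases "mat_inverse N") auto
  then show "inv_mat N \<in> carrier_mat n n" and "N * inv_mat N = 1\<^sub>m n"
    using mat_inverse(2)[OF N B] by auto
qed

lemma sym_pos_def_nonneg:
  assumes "sym_pos_def n M" and "v \<in> carrier_vec n"
  shows "0 \<le> v \<bullet> (M *\<^sub>v v)"
proof (cases "v = 0\<^sub>v n")
  case True
  have "0\<^sub>v n \<bullet> (M *\<^sub>v 0\<^sub>v n) = (0::real)"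
    by (rule scalar_prod_left_zero) (use assms in \<open>auto simp: sym_pos_def_def\<close>)
  then show ?thesis using True by simp
next
  case False
  then show ?thesis using assms by (auto simp: sym_pos_def_def intro: less_imp_le)
qed

lemma sym_pos_def_inverse:
  assumes "sym_pos_def n M"
  shows "inv_mat M \<in> carrier_mat n n" and "M * inv_mat M = 1\<^sub>m n"
proof -
  have M: "M \<in> carrier_mat n n" using assms by (simp add: sym_pos_def_def)
  have "v = 0\<^sub>v n" if v: "v \<in> carrier_vec n" and "M *\<^sub>v v = 0\<^sub>v n" for v
  proof (rule ccontr)
    assume "v \<noteq> 0\<^sub>v n"
    then have "v \<bullet> (M *\<^sub>v v) > 0" using assms v by (simp add: sym_pos_def_def)
    then show False using that by simp
  qed
  then show "inv_mat M \<in> carrier_mat n n" and "M * inv_mat M = 1\<^sub>m n"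
    using inv_mat_of_injective[OF M] by blast+
qed

lemma symmetric_form_commute:
  fixes S :: "real mat"
  assumes "S \<in> carrier_mat n n" and "transpose_mat S = S"
    and "v \<in> carrier_vec n" and "w \<in> carrier_vec n"
  shows "v \<bullet> (S *\<^sub>v w) = w \<bullet> (S *\<^sub>v v)"
proof -
  have "v \<bullet> (S *\<^sub>v w) = (S *\<^sub>v v) \<bullet> w"
    using transpose_vec_mult_scalar[of S n n w v] assms by simp
  also have "\<dots> = w \<bullet> (S *\<^sub>v v)"
    by (rule comm_scalar_prod[of _ n]) (use assms in auto)
  finally show ?thesis .
qed

lemma symmetric_form_minus:
  fixes S :: "real mat"
  assumes S: "S \<in> carrier_mat n n" and sym: "transpose_mat S = S"
    and v: "v \<in> carrier_vec n" and w: "w \<in> carrier_vec n"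
  shows "(v - w) \<bullet> (S *\<^sub>v (v - w)) = v \<bullet> (S *\<^sub>v v) - 2 * (w \<bullet> (S *\<^sub>v v)) + w \<bullet> (S *\<^sub>v w)"
proof -
  have c: "S *\<^sub>v v \<in> carrier_vec n" "S *\<^sub>v w \<in> carrier_vec n" using S v w by auto
  have "(v - w) \<bullet> (S *\<^sub>v (v - w)) = (v - w) \<bullet> (S *\<^sub>v v - S *\<^sub>v w)"
    using mult_minus_distrib_mat_vec[OF S v w] by simp
  also have "\<dots> = (v - w) \<bullet> (S *\<^sub>v v) - (v - w) \<bullet> (S *\<^sub>v w)"
    by (rule scalar_prod_minus_distrib[of _ n]) (use v w c in auto)
  also have "\<dots> = (v \<bullet> (S *\<^sub>v v) - w \<bullet> (S *\<^sub>v v)) - (v \<bullet> (S *\<^sub>v w) - w \<bullet> (S *\<^sub>v w))"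
    using minus_scalar_prod_distrib[OF v w c(1)] minus_scalar_prod_distrib[OF v w c(2)] by simp
  finally show ?thesis using symmetric_form_commute[OF S sym v w] by simp
qed

lemma sym_pos_def_Cauchy_Schwarz:
  assumes M: "sym_pos_def n M" and v: "v \<in> carrier_vec n" and w: "w \<in> carrier_vec n"
  shows "(v \<bullet> (M *\<^sub>v w))\<^sup>2 \<le> (v \<bullet> (M *\<^sub>v v)) * (w \<bullet> (M *\<^sub>v w))"
proof (cases "w = 0\<^sub>v n")
  case True
  have "M *\<^sub>v 0\<^sub>v n = 0\<^sub>v n" using M by (auto simp: sym_pos_def_def)
  then show ?thesis using True v by simp
next
  case False
  have Mc: "M \<in> carrier_mat n n" and sym: "transpose_mat M = M"
    using M by (auto simp: sym_pos_def_def)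
  define c where "c = w \<bullet> (M *\<^sub>v w)"
  define d where "d = w \<bullet> (M *\<^sub>v v)"
  have c: "c > 0" using M w False by (simp add: c_def sym_pos_def_def)
  have sw: "(d / c) \<cdot>\<^sub>v w \<in> carrier_vec n" using w by simp
  have Mv: "M *\<^sub>v v \<in> carrier_vec n" and Mw: "M *\<^sub>v w \<in> carrier_vec n" using Mc v w by auto
  \<comment> \<open>The factor \<open>d / c\<close> makes \<open>v - (d / c) w\<close> orthogonal to \<open>w\<close> with respect to \<open>M\<close>.\<close>
  have "0 \<le> (v - (d / c) \<cdot>\<^sub>v w) \<bullet> (M *\<^sub>v (v - (d / c) \<cdot>\<^sub>v w))"
    by (rule sym_pos_def_nonneg[OF M]) (use v w in auto)
  also have "\<dots> = v \<bullet> (M *\<^sub>v v) - 2 * ((d / c) * d) + (d / c) * ((d / c) * c)"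
    using symmetric_form_minus[OF Mc sym v sw] v w Mv Mw mult_mat_vec[OF Mc w]
    by (simp add: c_def d_def)
  also have "\<dots> = v \<bullet> (M *\<^sub>v v) - d\<^sup>2 / c"
    using c by (simp add: field_simps power2_eq_square)
  finally have "d\<^sup>2 \<le> (v \<bullet> (M *\<^sub>v v)) * c" using c by (simp add: field_simps)
  then show ?thesis using symmetric_form_commute[OF Mc sym v w] by (simp add: c_def d_def)
qed

text \<open>
  The usual reason is a lower bound \<open>v \<bullet> M v \<ge> c (v \<bullet> v)\<close> with \<open>c > 0\<close>, taken from compactness of
  the unit sphere or from the smallest eigenvalue. It is simpler to control one coordinate at a
  time: since \<open>M\<close> is invertible, each coordinate is a functional of the form \<open>\<lambda>e. v \<bullet> M e\<close>, to
  which Cauchy--Schwarz applies.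
\<close>

lemma vec_tendsto_if_energy_tendsto_0:
  assumes M: "sym_pos_def n M"
    and x: "\<And>k. x k \<in> carrier_vec n" and l: "l \<in> carrier_vec n"
    and energy: "(\<lambda>k. (x k - l) \<bullet> (M *\<^sub>v (x k - l))) \<longlonglongrightarrow> 0"
  shows "vec_tendsto x l"
proof -
  have Mc: "M \<in> carrier_mat n n" and sym: "transpose_mat M = M"
    using M by (auto simp: sym_pos_def_def)
  have e: "x k - l \<in> carrier_vec n" for k using x l by simp
  have coord: "(\<lambda>k. ((x k - l) $ i)\<^sup>2) \<longlonglongrightarrow> 0" if i: "i < n" for i
  proof -
    define v where "v = inv_mat M *\<^sub>v unit_vec n i"
    have v: "v \<in> carrier_vec n"
      using sym_pos_def_inverse(1)[OF M] by (simp add: v_def)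
    have Mv: "M *\<^sub>v v = unit_vec n i"
      using assoc_mult_mat_vec[OF Mc sym_pos_def_inverse(1)[OF M], of "unit_vec n i"]
        sym_pos_def_inverse(2)[OF M] by (simp add: v_def)
    have bound: "((x k - l) $ i)\<^sup>2 \<le> (v \<bullet> (M *\<^sub>v v)) * ((x k - l) \<bullet> (M *\<^sub>v (x k - l)))" for k
    proof -
      have "v \<bullet> (M *\<^sub>v (x k - l)) = (x k - l) $ i"
        using symmetric_form_commute[OF Mc sym v e] Mv i by simp
      then show ?thesis using sym_pos_def_Cauchy_Schwarz[OF M v e, of k] by simp
    qed
    have "(\<lambda>k. (v \<bullet> (M *\<^sub>v v)) * ((x k - l) \<bullet> (M *\<^sub>v (x k - l)))) \<longlonglongrightarrow> 0"
      using tendsto_mult_right_zero[OF energy] by simp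
    then show ?thesis
      by (rule tendsto_sandwich[where f = "\<lambda>_. 0",
            OF always_eventually always_eventually tendsto_const, rotated 2])
        (use bound in auto)
  qed
  have "(\<lambda>k. \<Sum>i\<in>{0..<n}. ((x k - l) $ i)\<^sup>2) \<longlonglongrightarrow> 0"
    using coord by (intro tendsto_null_sum) auto
  moreover have "(x k - l) \<bullet> (x k - l) = (\<Sum>i\<in>{0..<n}. ((x k - l) $ i)\<^sup>2)" for k
    using e[of k] l by (simp add: scalar_prod_def power2_eq_square)
  ultimately have "(\<lambda>k. (x k - l) \<bullet> (x k - l)) \<longlonglongrightarrow> 0" by simp
  then have "(\<lambda>k. sqrt ((x k - l) \<bullet> (x k - l))) \<longlonglongrightarrow> 0"
    using tendsto_real_sqrt by fastforce
  then show ?thesis using x l by (simp add: vec_tendsto_def)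
qed

section \<open>The indefinite least squares problem\<close>

lemma scalar_prod_transpose_mult:
  fixes B :: "real mat"
  assumes B: "B \<in> carrier_mat m n" and v: "v \<in> carrier_vec n" and w: "w \<in> carrier_vec m"
  shows "v \<bullet> (transpose_mat B *\<^sub>v w) = (B *\<^sub>v v) \<bullet> w"
proof -
  have "v \<bullet> (transpose_mat B *\<^sub>v w) = (transpose_mat B *\<^sub>v w) \<bullet> v"
    by (rule comm_scalar_prod[of _ n]) (use assms in auto)
  also have "\<dots> = w \<bullet> (B *\<^sub>v v)" by (rule transpose_vec_mult_scalar[OF B v w])
  also have "\<dots> = (B *\<^sub>v v) \<bullet> w"
    by (rule comm_scalar_prod[of _ m]) (use assms in auto)
  finally show ?thesis .
qed

lemma scalar_prod_gram:
  fixes B :: "real mat"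
  assumes B: "B \<in> carrier_mat m n" and v: "v \<in> carrier_vec n" and w: "w \<in> carrier_vec n"
  shows "v \<bullet> ((transpose_mat B * B) *\<^sub>v w) = (B *\<^sub>v v) \<bullet> (B *\<^sub>v w)"
  using scalar_prod_transpose_mult[OF B v, of "B *\<^sub>v w"] assms
  by (simp add: assoc_mult_mat_vec[of _ n m])

lemma triple_product_mult_vec:
  fixes A J :: "real mat"
  assumes A: "A \<in> carrier_mat m n" and J: "J \<in> carrier_mat m m" and z: "z \<in> carrier_vec n"
  shows "(transpose_mat A * J * A) *\<^sub>v z = transpose_mat A *\<^sub>v (J *\<^sub>v (A *\<^sub>v z))"
proof -
  have AT: "transpose_mat A \<in> carrier_mat n m" using A by simp
  show ?thesis
    using assoc_mult_mat_vec[OF mult_carrier_mat[OF AT J] A z]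
      assoc_mult_mat_vec[OF AT J mult_mat_vec_carrier[OF A z]] by (rule trans)
qed

lemma signature_mat_carrier: "signature_mat p q \<in> carrier_mat (p + q) (p + q)"
  by (simp add: signature_mat_def)

lemma transpose_signature_mat: "transpose_mat (signature_mat p q) = signature_mat p q"
  by (rule eq_matI) (auto simp: signature_mat_def)

lemma signature_mat_mult_append:
  assumes u: "u \<in> carrier_vec p" and w: "w \<in> carrier_vec q"
  shows "signature_mat p q *\<^sub>v (u @\<^sub>v w) = u @\<^sub>v (- w)"
  unfolding signature_mat_def
  by (subst four_block_mat_mult_vec[of _ p p _ q _ q]) (use assms in auto)

lemma scalar_prod_normal_matrix:
  assumes A\<^sub>1: "A\<^sub>1 \<in> carrier_mat p n" and A\<^sub>2: "A\<^sub>2 \<in> carrier_mat q n"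
    and v: "v \<in> carrier_vec n" and w: "w \<in> carrier_vec n"
  shows "v \<bullet> ((transpose_mat (A\<^sub>1 @\<^sub>r A\<^sub>2) * signature_mat p q * (A\<^sub>1 @\<^sub>r A\<^sub>2)) *\<^sub>v w)
       = (A\<^sub>1 *\<^sub>v v) \<bullet> (A\<^sub>1 *\<^sub>v w) - (A\<^sub>2 *\<^sub>v v) \<bullet> (A\<^sub>2 *\<^sub>v w)"
proof -
  let ?A = "A\<^sub>1 @\<^sub>r A\<^sub>2" and ?J = "signature_mat p q"
  have A: "?A \<in> carrier_mat (p + q) n" using A\<^sub>1 A\<^sub>2 by simp
  note J = signature_mat_carrier[of p q]
  have 1: "A\<^sub>1 *\<^sub>v v \<in> carrier_vec p" "A\<^sub>1 *\<^sub>v w \<in> carrier_vec p"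
    and 2: "A\<^sub>2 *\<^sub>v v \<in> carrier_vec q" "A\<^sub>2 *\<^sub>v w \<in> carrier_vec q"
    using A\<^sub>1 A\<^sub>2 v w by auto
  have "v \<bullet> ((transpose_mat ?A * ?J * ?A) *\<^sub>v w) = v \<bullet> (transpose_mat ?A *\<^sub>v (?J *\<^sub>v (?A *\<^sub>v w)))"
    by (subst triple_product_mult_vec[OF A J w]) (rule refl)
  also have "\<dots> = (?A *\<^sub>v v) \<bullet> (?J *\<^sub>v (?A *\<^sub>v w))"
    by (rule scalar_prod_transpose_mult[OF A v]) (use A J w in auto)
  also have "\<dots> = (A\<^sub>1 *\<^sub>v v @\<^sub>v A\<^sub>2 *\<^sub>v v) \<bullet> (A\<^sub>1 *\<^sub>v w @\<^sub>v - (A\<^sub>2 *\<^sub>v w))"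
    using mat_mult_append[OF A\<^sub>1 A\<^sub>2] v w signature_mat_mult_append[OF 1(2) 2(2)] by simp
  also have "\<dots> = (A\<^sub>1 *\<^sub>v v) \<bullet> (A\<^sub>1 *\<^sub>v w) + (A\<^sub>2 *\<^sub>v v) \<bullet> (- (A\<^sub>2 *\<^sub>v w))"
    by (rule scalar_prod_append[of _ p _ q]) (use 1 2 in auto)
  finally show ?thesis using 2 by simp
qed

text \<open>
  At a solution \<open>l\<close> of the normal equation the residual \<open>b - A l\<close> is \<open>J\<close>-orthogonal to the range of
  \<open>A\<close>, so moving to \<open>l + d\<close> changes the objective by exactly \<open>d \<bullet> A\<^sup>T J A d \<ge> 0\<close>.
\<close>

lemma ils_solution_if_normal_equation:
  assumes A: "A \<in> carrier_mat m n" and J: "J \<in> carrier_mat m m" and sym: "transpose_mat J = J"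
    and b: "b \<in> carrier_vec m" and l: "l \<in> carrier_vec n"
    and pos: "sym_pos_def n (transpose_mat A * J * A)"
    and normal: "(transpose_mat A * J * A) *\<^sub>v l = transpose_mat A *\<^sub>v (J *\<^sub>v b)"
  shows "ils_solution n A J b l"
proof -
  let ?f = "\<lambda>y. (b - A *\<^sub>v y) \<bullet> (J *\<^sub>v (b - A *\<^sub>v y))"
  have "?f l \<le> ?f y" if y: "y \<in> carrier_vec n" for y
  proof -
    define r d where "r = b - A *\<^sub>v l" and "d = y - l"
    have Al: "A *\<^sub>v l \<in> carrier_vec m" using A l by simp
    have r: "r \<in> carrier_vec m" and d: "d \<in> carrier_vec n" and Ad: "A *\<^sub>v d \<in> carrier_vec m"
      using A b l y by (auto simp: r_def d_def)
    have M: "(transpose_mat A * J * A) *\<^sub>v z = transpose_mat A *\<^sub>v (J *\<^sub>v (A *\<^sub>v z))"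
      if "z \<in> carrier_vec n" for z
      by (rule triple_product_mult_vec[OF A J that])
    have "(A *\<^sub>v d) \<bullet> (J *\<^sub>v r) = d \<bullet> (transpose_mat A *\<^sub>v (J *\<^sub>v r))"
      using scalar_prod_transpose_mult[OF A d, of "J *\<^sub>v r"] J r by simp
    also have "transpose_mat A *\<^sub>v (J *\<^sub>v r)
        = transpose_mat A *\<^sub>v (J *\<^sub>v b) - transpose_mat A *\<^sub>v (J *\<^sub>v (A *\<^sub>v l))"
      using mult_minus_distrib_mat_vec[OF J b Al]
        mult_minus_distrib_mat_vec[of "transpose_mat A" n m "J *\<^sub>v b" "J *\<^sub>v (A *\<^sub>v l)"] A J b Al
      by (simp add: r_def)
    also have "\<dots> = 0\<^sub>v n"
      using normal M[OF l] A J b by (auto simp: minus_cancel_vec)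
    finally have orth: "(A *\<^sub>v d) \<bullet> (J *\<^sub>v r) = 0" using d by simp
    have "0 \<le> d \<bullet> ((transpose_mat A * J * A) *\<^sub>v d)" by (rule sym_pos_def_nonneg[OF pos d])
    also have "\<dots> = (A *\<^sub>v d) \<bullet> (J *\<^sub>v (A *\<^sub>v d))"
      using M[OF d] scalar_prod_transpose_mult[OF A d, of "J *\<^sub>v (A *\<^sub>v d)"] J Ad by simp
    finally have curv: "0 \<le> (A *\<^sub>v d) \<bullet> (J *\<^sub>v (A *\<^sub>v d))" .
    have "b - A *\<^sub>v y = r - A *\<^sub>v d"
      using mult_minus_distrib_mat_vec[OF A y l] A b l y
      by (intro eq_vecI) (auto simp: r_def d_def)
    then show ?thesis
      using symmetric_form_minus[OF J sym r Ad] orth curv by (simp add: r_def)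
  qed
  then show ?thesis using l by (auto simp: ils_solution_def is_arg_min_linorder)
qed

section \<open>The splitting iteration\<close>

text \<open>
  With \<open>u = A\<^sub>2 e'\<close> and \<open>w = A\<^sub>2 e\<close>, twice the new energy is \<open>2 u \<bullet> w \<le> u \<bullet> u + w \<bullet> w\<close>, where
  \<open>u \<bullet> u\<close> is at most the new energy again by \<open>dom\<close>. Hence the new energy is at most \<open>w \<bullet> w\<close>. Both
  sides are written relative to the old energy \<open>A\<^sub>1 e \<bullet> A\<^sub>1 e\<close>, so that the left one is the
  \<open>M\<close>-energy of \<open>e\<close> and the right one telescopes along the iteration.
\<close>

lemma splitting_step_energy_drop:
  fixes A\<^sub>1 A\<^sub>2 :: "real mat"
  assumes A\<^sub>1: "A\<^sub>1 \<in> carrier_mat p n" and A\<^sub>2: "A\<^sub>2 \<in> carrier_mat q n"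
    and e: "e \<in> carrier_vec n" and e': "e' \<in> carrier_vec n"
    and dom: "(A\<^sub>2 *\<^sub>v e') \<bullet> (A\<^sub>2 *\<^sub>v e') \<le> (A\<^sub>1 *\<^sub>v e') \<bullet> (A\<^sub>1 *\<^sub>v e')"
    and step: "(A\<^sub>1 *\<^sub>v e') \<bullet> (A\<^sub>1 *\<^sub>v e') = (A\<^sub>2 *\<^sub>v e') \<bullet> (A\<^sub>2 *\<^sub>v e)"
  shows "(A\<^sub>1 *\<^sub>v e) \<bullet> (A\<^sub>1 *\<^sub>v e) - (A\<^sub>2 *\<^sub>v e) \<bullet> (A\<^sub>2 *\<^sub>v e)
       \<le> (A\<^sub>1 *\<^sub>v e) \<bullet> (A\<^sub>1 *\<^sub>v e) - (A\<^sub>1 *\<^sub>v e') \<bullet> (A\<^sub>1 *\<^sub>v e')"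
proof -
  define u w where "u = A\<^sub>2 *\<^sub>v e'" and "w = A\<^sub>2 *\<^sub>v e"
  have u: "u \<in> carrier_vec q" and w: "w \<in> carrier_vec q" using A\<^sub>2 e e' by (auto simp: u_def w_def)
  have "0 \<le> (u - w) \<bullet> (u - w)" by (auto simp: scalar_prod_def intro: sum_nonneg)
  also have "\<dots> = u \<bullet> u - 2 * (u \<bullet> w) + w \<bullet> w"
    using symmetric_form_minus[of "1\<^sub>m q" q u w] comm_scalar_prod[OF u w] u w by simp
  finally show ?thesis using dom step by (simp add: u_def w_def)
qed

theorem theorem2p1:
  fixes m n p q :: nat
    and A A\<^sub>1 A\<^sub>2 J :: "real mat"
    and b :: "real vec"
    and x :: "nat \<Rightarrow> real vec"
  assumes "m \<ge> n" and "p + q = m"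
    and "A\<^sub>1 \<in> carrier_mat p n" and "A\<^sub>2 \<in> carrier_mat q n"
    and "A = A\<^sub>1 @\<^sub>r A\<^sub>2"
    and "b \<in> carrier_vec m"
    and "J = signature_mat p q"
    and "sym_pos_def n (transpose_mat A * J * A)"
    and "x 0 \<in> carrier_vec n"
    and "\<And>k. x (Suc k) =
           (inv_mat (transpose_mat A\<^sub>1 * A\<^sub>1) * (transpose_mat A\<^sub>2 * A\<^sub>2)) *\<^sub>v x k
           + (inv_mat (transpose_mat A\<^sub>1 * A\<^sub>1) * transpose_mat A * J) *\<^sub>v b"
  shows "\<exists>l. ils_solution n A J b l \<and> vec_tendsto x l"
proof -
  note A\<^sub>1 = assms(3) and A\<^sub>2 = assms(4) and b = assms(6) and pos = assms(8) and rec = assms(10)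
  let ?P = "transpose_mat A\<^sub>1 * A\<^sub>1" and ?Q = "transpose_mat A\<^sub>2 * A\<^sub>2"
  define M where "M = transpose_mat A * J * A"
  define c where "c = transpose_mat A *\<^sub>v (J *\<^sub>v b)"
  have A: "A \<in> carrier_mat m n" using A\<^sub>1 A\<^sub>2 assms(2,5) carrier_append_rows by blast
  have J: "J \<in> carrier_mat m m" using assms(2,7) signature_mat_carrier by blast
  have P: "?P \<in> carrier_mat n n" and Q: "?Q \<in> carrier_mat n n" using A\<^sub>1 A\<^sub>2 by auto
  have c: "c \<in> carrier_vec n" using A J b by (auto simp: c_def)
  have pd: "sym_pos_def n M" and M: "M \<in> carrier_mat n n"
    using pos by (auto simp: M_def sym_pos_def_def)
  have form: "v \<bullet> (M *\<^sub>v w) = (A\<^sub>1 *\<^sub>v v) \<bullet> (A\<^sub>1 *\<^sub>v w) - (A\<^sub>2 *\<^sub>v v) \<bullet> (A\<^sub>2 *\<^sub>v w)"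
    if "v \<in> carrier_vec n" "w \<in> carrier_vec n" for v w
    using scalar_prod_normal_matrix[OF A\<^sub>1 A\<^sub>2 that] assms(5,7) by (simp add: M_def)
  have sq: "0 \<le> u \<bullet> u" for u :: "real vec" by (auto simp: scalar_prod_def intro: sum_nonneg)
  have "v = 0\<^sub>v n" if v: "v \<in> carrier_vec n" and Pv: "?P *\<^sub>v v = 0\<^sub>v n" for v
  proof (rule ccontr)
    assume "v \<noteq> 0\<^sub>v n"
    then have "0 < v \<bullet> (M *\<^sub>v v)" using pd v by (simp add: sym_pos_def_def)
    also have "\<dots> \<le> v \<bullet> (?P *\<^sub>v v)"
      using form[OF v v] sq[of "A\<^sub>2 *\<^sub>v v"] scalar_prod_gram[OF A\<^sub>1 v v] by simp
    finally show False using Pv v by simp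
  qed
  note Pinv = inv_mat_of_injective[OF P this]
  define l where "l = inv_mat M *\<^sub>v c"
  have l: "l \<in> carrier_vec n" using sym_pos_def_inverse(1)[OF pd] c by (simp add: l_def)
  have Ml: "M *\<^sub>v l = c"
    using assoc_mult_mat_vec[OF M sym_pos_def_inverse(1)[OF pd] c] sym_pos_def_inverse(2)[OF pd] c
    by (simp add: l_def)
  have sol: "ils_solution n A J b l"
    by (rule ils_solution_if_normal_equation[OF A J _ b l pos])
      (use Ml assms(7) transpose_signature_mat in \<open>auto simp: M_def c_def\<close>)
  have rec': "x (Suc k) = inv_mat ?P *\<^sub>v (?Q *\<^sub>v x k + c)" if "x k \<in> carrier_vec n" for k
  proof -
    have "(inv_mat ?P * ?Q) *\<^sub>v x k = inv_mat ?P *\<^sub>v (?Q *\<^sub>v x k)"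
      by (rule assoc_mult_mat_vec[OF Pinv(1) Q that])
    moreover have "(inv_mat ?P * transpose_mat A * J) *\<^sub>v b = inv_mat ?P *\<^sub>v c"
    proof -
      have AT: "transpose_mat A \<in> carrier_mat n m" using A by simp
      have "(inv_mat ?P * transpose_mat A * J) *\<^sub>v b = (inv_mat ?P * transpose_mat A) *\<^sub>v (J *\<^sub>v b)"
        by (rule assoc_mult_mat_vec[OF mult_carrier_mat[OF Pinv(1) AT] J b])
      also have "\<dots> = inv_mat ?P *\<^sub>v c"
        unfolding c_def by (rule assoc_mult_mat_vec[OF Pinv(1) AT]) (use J b in auto)
      finally show ?thesis .
    qed
    ultimately show ?thesis
      using rec[of k] mult_add_distrib_mat_vec[OF Pinv(1), of "?Q *\<^sub>v x k" c]
        mult_mat_vec_carrier[OF Q that] c by simp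
  qed
  have x: "x k \<in> carrier_vec n" for k
  proof (induction k)
    case 0
    show ?case by (rule assms(9))
  next
    case (Suc k)
    show ?case
      unfolding rec'[OF Suc]
      by (rule mult_mat_vec_carrier[OF Pinv(1)]) (use mult_mat_vec_carrier[OF Q Suc] c in auto)
  qed
  have Px: "?P *\<^sub>v x (Suc k) = ?Q *\<^sub>v x k + c" for k
  proof -
    have Qc: "?Q *\<^sub>v x k + c \<in> carrier_vec n" using mult_mat_vec_carrier[OF Q x] c by simp
    have "?P *\<^sub>v x (Suc k) = (?P * inv_mat ?P) *\<^sub>v (?Q *\<^sub>v x k + c)"
      using assoc_mult_mat_vec[OF P Pinv(1) Qc] rec'[OF x] by simp
    then show ?thesis using Pinv(2) Qc by simp
  qed
  define e where "e = (\<lambda>k. x k - l)"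
  have e: "e k \<in> carrier_vec n" for k using x l by (simp add: e_def)
  \<comment> \<open>The error equation in weak form: the step equation tested against \<open>v\<close>, minus the normal
    equation for \<open>l\<close> tested against \<open>v\<close>.\<close>
  have err: "(A\<^sub>1 *\<^sub>v v) \<bullet> (A\<^sub>1 *\<^sub>v e (Suc k)) = (A\<^sub>2 *\<^sub>v v) \<bullet> (A\<^sub>2 *\<^sub>v e k)"
    if v: "v \<in> carrier_vec n" for v k
  proof -
    have "(A\<^sub>1 *\<^sub>v v) \<bullet> (A\<^sub>1 *\<^sub>v x (Suc k)) = v \<bullet> (?Q *\<^sub>v x k + c)"
      using scalar_prod_gram[OF A\<^sub>1 v x, of "Suc k"] Px[of k] by simp
    also have "\<dots> = (A\<^sub>2 *\<^sub>v v) \<bullet> (A\<^sub>2 *\<^sub>v x k) + v \<bullet> c"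
      using scalar_prod_add_distrib[OF v mult_mat_vec_carrier[OF Q x] c, of k]
        scalar_prod_gram[OF A\<^sub>2 v x, of k] by simp
    finally have "(A\<^sub>1 *\<^sub>v v) \<bullet> (A\<^sub>1 *\<^sub>v x (Suc k)) = (A\<^sub>2 *\<^sub>v v) \<bullet> (A\<^sub>2 *\<^sub>v x k) + v \<bullet> c" .
    moreover have "(A\<^sub>1 *\<^sub>v v) \<bullet> (A\<^sub>1 *\<^sub>v l) - (A\<^sub>2 *\<^sub>v v) \<bullet> (A\<^sub>2 *\<^sub>v l) = v \<bullet> c"
      using form[OF v l] Ml by simp
    moreover have minus: "(B *\<^sub>v v) \<bullet> (B *\<^sub>v e j) = (B *\<^sub>v v) \<bullet> (B *\<^sub>v x j) - (B *\<^sub>v v) \<bullet> (B *\<^sub>v l)"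
      if B: "B \<in> carrier_mat r n" for B :: "real mat" and r j
      using mult_minus_distrib_mat_vec[OF B x l]
        scalar_prod_minus_distrib[of "B *\<^sub>v v" r "B *\<^sub>v x j" "B *\<^sub>v l"]
        mult_mat_vec_carrier[OF B] v x l by (simp add: e_def)
    ultimately show ?thesis using minus[OF A\<^sub>1, of "Suc k"] minus[OF A\<^sub>2, of k] by simp
  qed
  define a where "a = (\<lambda>k. (A\<^sub>1 *\<^sub>v e k) \<bullet> (A\<^sub>1 *\<^sub>v e k))"
  have drop: "e k \<bullet> (M *\<^sub>v e k) \<le> a k - a (Suc k)" for k
  proof -
    have "(A\<^sub>2 *\<^sub>v e (Suc k)) \<bullet> (A\<^sub>2 *\<^sub>v e (Suc k)) \<le> (A\<^sub>1 *\<^sub>v e (Suc k)) \<bullet> (A\<^sub>1 *\<^sub>v e (Suc k))"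
      using sym_pos_def_nonneg[OF pd e] form[OF e e] by (metis diff_ge_0_iff_ge)
    from splitting_step_energy_drop[OF A\<^sub>1 A\<^sub>2 e e this err[OF e]]
    show ?thesis using form[OF e e] by (simp add: a_def)
  qed
  have nonneg: "0 \<le> e k \<bullet> (M *\<^sub>v e k)" for k by (rule sym_pos_def_nonneg[OF pd e])
  have "a (Suc k) \<le> a k" for k using drop[of k] nonneg[of k] by linarith
  then have "decseq a" by (rule decseq_SucI)
  moreover have "0 \<le> a k" for k by (simp add: a_def sq)
  ultimately obtain \<alpha> where \<alpha>: "a \<longlonglongrightarrow> \<alpha>" using decseq_convergent[of a 0] by blast
  have "(\<lambda>k. a k - a (Suc k)) \<longlonglongrightarrow> \<alpha> - \<alpha>" by (intro tendsto_diff \<alpha> LIMSEQ_Suc)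
  then have "(\<lambda>k. a k - a (Suc k)) \<longlonglongrightarrow> 0" by simp
  then have "(\<lambda>k. e k \<bullet> (M *\<^sub>v e k)) \<longlonglongrightarrow> 0"
    by (rule tendsto_sandwich[where f = "\<lambda>_. 0",
          OF always_eventually always_eventually tendsto_const, rotated 2])
      (use drop nonneg in auto)
  then have "vec_tendsto x l"
    unfolding e_def by (rule vec_tendsto_if_energy_tendsto_0[OF pd x l])
  with sol show ?thesis by blast
qed

end
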